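(* Let all assumptions listed in the context hold, let $F$ be concave, let $x^*$ be a maximizer of $F$ over $\mathcal{C}$ and $x^0\in\mathcal{C}$. Take the SFW++ parameters $|\mathcal{M}_h^t|=16(t+2)$ and $|\mathcal{M}_0^t|=\frac{G^2(t+1)^2}{\bar L^2D^2}$. Assume that $\epsilon>0$ is such that $t=\frac{28\bar LD^2+(F(x^* )-F(x^0))}{\epsilon}=2^K$ for some $K\in\mathbb{N}$. Then the overall stochastic complexity of SFW++ up to iteration $t$ satisfies $$\sum_{i=0}^{t}|\mathcal{M}_h^i|+\sum_{k=0}^{K}|\mathcal{M}_0^{2^k}|=O\!\left(\frac{\bar L^2D^4}{\epsilon^2}+\frac{G^2D^2}{\epsilon^2}+\frac{G^2(F(x^* )-F(x^0))^2}{\bar L^2D^2\epsilon^2}\right),$$ with an absolute implied constant.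
   Context: Setting. $\mathcal{C}\subset\mathbb{R}^d$ is nonempty, convex and compact with diameter $D>0$. For $x$ in an open set $U\supseteq\mathcal{C}$, $p(\cdot;x)$ is a probability density on a space $\mathcal{Z}$, $\tilde F:U\times\mathcal{Z}\to\mathbb{R}$, and $\tilde F(\cdot;z)$, $\log p(z;\cdot)$ are twice differentiable. $F(x)=\mathbb{E}_{z\sim p(z;x)}[\tilde F(x;z)]$. Assumptions. For all $x\in\mathcal{C}$, $z\in\mathcal{Z}$: $|\tilde F(x;z)|\le B$; $\|\nabla\tilde F(x;z)\|\le G_{\tilde F}$ and $\mathbb{E}_{z\sim p(z;x)}\|\nabla\log p(z;x)\|^4\le G_p^4$, $G=\max\{G_{\tilde F},G_p\}$; $\|\nabla^2\tilde F(x;z)\|\le L_{\tilde F}$ and $\mathbb{E}_{z\sim p(z;x)}\|\nabla^2\log p(z;x)\|^2\le L_p^2$, $L=\max\{L_{\tilde F},L_p\}$; $\nabla^2\tilde F(\cdot;z)$ and $\nabla^2\log p(z;\cdot)$ are Lipschitz on $\mathcal{C}$ uniformly in $z$. Standing: $F$ is twice continuously differentiable and stochastic gradients are unbiased, $\mathbb{E}_{z\sim p(z;x)}[\nabla\tilde F(x;z)]=\nabla F(x)$ for $x\in\mathcal{C}$. $\bar L>0$ is defined by $\bar L^2=4B^2G^4+16G^4+4L^2+4B^2L^2$. Algorithm SFW++ (concave version): at iteration $t$, if $t=0$ or $t$ is a power of two, it draws a minibatch $\mathcal{M}_0^t$ of samples $z\sim p(z;x^t)$ and uses the average of $\nabla\tilde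 F(x^t;z)$ as gradient estimate $g^t$; otherwise it draws a minibatch $\mathcal{M}_h^t$ of pairs $(a,z(a))$ ($a$ uniform on $[0,1]$, $z(a)\sim p(\cdot;ax^t+(1-a)x^{t-1})$) and sets $g^t=g^{t-1}+\tilde\nabla^2_t(x^t-x^{t-1})$ with $\tilde\nabla^2_t$ an averaged stochastic Hessian; then $x^{t+1}=x^t+\frac{2}{t+2}(v^t-x^t)$ with $v^t\in\arg\max_{v\in\mathcal{C}}\langle v,g^t\rangle$. The overall stochastic complexity is measured by the total number of samples as displayed in the claim. The value $t=(28\bar LD^2+F(x^* )-F(x^0))/\epsilon$ is the number of iterations guaranteeing $F(x^* )-\mathbb{E}[F(x^t)]\le\epsilon$. *)

theory Defs
  imports "HOL-Probability.Probability"
begin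

section \<open>Gradients and Hessians\<close>

definition gradient :: "('a::euclidean_space \<Rightarrow> real) \<Rightarrow> 'a \<Rightarrow> 'a" where
  "gradient f x = (THE D. GDERIV f x :> D)"

text \<open>The Hessian is kept as the linear map \<open>h \<mapsto> \<nabla>\<^sup>2f(x) h\<close>; its spectral norm is \<^const>\<open>onorm\<close>.\<close>

definition hessian :: "('a::euclidean_space \<Rightarrow> real) \<Rightarrow> 'a \<Rightarrow> 'a \<Rightarrow> 'a" where
  "hessian f x = frechet_derivative (gradient f) (at x)"

definition twice_differentiable_on :: "('a::euclidean_space \<Rightarrow> real) \<Rightarrow> 'a set \<Rightarrow> bool" where
  "twice_differentiable_on f U \<longleftrightarrow>
     (\<forall>x\<in>U. f differentiable (at x) \<and> gradient f differentiable (at x))"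

lemma gradient_eqI:
  fixes f :: "'a::euclidean_space \<Rightarrow> real"
  assumes "GDERIV f x :> D"
  shows "gradient f x = D"
  unfolding gradient_def
proof (rule the_equality)
  show "GDERIV f x :> D" by (fact assms)
next
  fix D' assume "GDERIV f x :> D'"
  with assms have "(\<lambda>h. inner h D') = (\<lambda>h. inner h D)"
    unfolding gderiv_def using has_derivative_unique by blast
  then show "D' = D"
    by (metis inner_commute vector_eq_ldot)
qed

lemma differentiable_imp_GDERIV:
  fixes f :: "'a::euclidean_space \<Rightarrow> real"
  assumes "f differentiable (at x)"
  shows "GDERIV f x :> gradient f x"
proof -
  obtain f' where f': "(f has_derivative f') (at x)"
    using assms unfolding differentiable_def by blast
  then interpret bounded_linear f' by (rule has_derivative_bounded_linear)
  define D where "D = (\<Sum>b\<in>Basis. f' b *\<^sub>R b)"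
  have "f' h = inner h D" for h
  proof -
    have "f' h = f' (\<Sum>b\<in>Basis. (h \<bullet> b) *\<^sub>R b)"
      by (simp add: euclidean_representation)
    also have "\<dots> = (\<Sum>b\<in>Basis. (h \<bullet> b) * f' b)"
      by (simp add: sum scaleR)
    also have "\<dots> = inner h D"
      by (simp add: D_def inner_sum_right mult.commute)
    finally show ?thesis .
  qed
  then have "f' = (\<lambda>h. inner h D)" by auto
  with f' have "GDERIV f x :> D" unfolding gderiv_def by simp
  then show ?thesis using gradient_eqI by metis
qed

section \<open>The non-oblivious stochastic problem\<close>

text \<open>\<open>\<nu>\<close> is the reference measure of the sample space; \<open>p z x\<close> stands for \<open>p(z;x)\<close> and
  \<open>Ft x z\<close> for the stochastic function.\<close>

definition sample_law :: "'z measure \<Rightarrow> ('z \<Rightarrow> 'a \<Rightarrow> real) \<Rightarrow> 'a \<Rightarrow> 'z measure" where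
  "sample_law \<nu> p x = density \<nu> (\<lambda>z. ennreal (p z x))"

definition objective ::
    "'z measure \<Rightarrow> ('z \<Rightarrow> 'a \<Rightarrow> real) \<Rightarrow> ('a \<Rightarrow> 'z \<Rightarrow> real) \<Rightarrow> 'a \<Rightarrow> real" where
  "objective \<nu> p Ft x = (LINT z|sample_law \<nu> p x. Ft x z)"

text \<open>Positivity of \<open>p\<close> on \<open>U\<close> is what makes \<open>log p\<close> meaningful (\<^const>\<open>ln\<close> is total), and the
  measurability and integrability clauses are those needed for the expectations to be genuine
  rather than the default value of the Bochner integral. \<open>p\<close> and \<open>Ft\<close> are
  differentiated in their \<open>x\<close>-argument only.\<close>

locale stochastic_problem =
  fixes C U :: "'a::euclidean_space set"
    and \<nu> :: "'z measure"
    and p :: "'z \<Rightarrow> 'a \<Rightarrow> real"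
    and Ft :: "'a \<Rightarrow> 'z \<Rightarrow> real"
    and B GF Gp LF Lp :: real
  assumes domain: "C \<noteq> {}" "convex C" "compact C" "diameter C > 0" "open U" "C \<subseteq> U"
    and density_pos: "\<And>x z. x \<in> U \<Longrightarrow> z \<in> space \<nu> \<Longrightarrow> p z x > 0"
    and density_measurable: "\<And>x. x \<in> U \<Longrightarrow> (\<lambda>z. p z x) \<in> borel_measurable \<nu>"
    and density_prob: "\<And>x. x \<in> U \<Longrightarrow> prob_space (sample_law \<nu> p x)"
    and Ft_integrable: "\<And>x. x \<in> U \<Longrightarrow> integrable (sample_law \<nu> p x) (Ft x)"
    and Ft_smooth: "\<And>z. z \<in> space \<nu> \<Longrightarrow> twice_differentiable_on (\<lambda>x. Ft x z) U"
    and log_p_smooth: "\<And>z. z \<in> space \<nu> \<Longrightarrow> twice_differentiable_on (\<lambda>x. ln (p z x)) U"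
    and Gp_nonneg: "Gp \<ge> 0" and Lp_nonneg: "Lp \<ge> 0"
    and Ft_bound: "\<And>x z. x \<in> C \<Longrightarrow> z \<in> space \<nu> \<Longrightarrow> \<bar>Ft x z\<bar> \<le> B"
    and grad_Ft_bound:
      "\<And>x z. x \<in> C \<Longrightarrow> z \<in> space \<nu> \<Longrightarrow> norm (gradient (\<lambda>y. Ft y z) x) \<le> GF"
    and grad_log_p_integrable: "\<And>x. x \<in> C \<Longrightarrow>
      integrable (sample_law \<nu> p x) (\<lambda>z. norm (gradient (\<lambda>y. ln (p z y)) x) ^ 4)"
    and grad_log_p_bound: "\<And>x. x \<in> C \<Longrightarrow>
      (LINT z|sample_law \<nu> p x. norm (gradient (\<lambda>y. ln (p z y)) x) ^ 4) \<le> Gp ^ 4"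
    and hess_Ft_bound:
      "\<And>x z. x \<in> C \<Longrightarrow> z \<in> space \<nu> \<Longrightarrow> onorm (hessian (\<lambda>y. Ft y z) x) \<le> LF"
    and hess_log_p_integrable: "\<And>x. x \<in> C \<Longrightarrow>
      integrable (sample_law \<nu> p x) (\<lambda>z. (onorm (hessian (\<lambda>y. ln (p z y)) x))\<^sup>2)"
    and hess_log_p_bound: "\<And>x. x \<in> C \<Longrightarrow>
      (LINT z|sample_law \<nu> p x. (onorm (hessian (\<lambda>y. ln (p z y)) x))\<^sup>2) \<le> Lp\<^sup>2"
    and hess_Ft_lipschitz: "\<exists>M. \<forall>z\<in>space \<nu>. \<forall>x\<in>C. \<forall>y\<in>C.
      onorm (\<lambda>h. hessian (\<lambda>u. Ft u z) x h - hessian (\<lambda>u. Ft u z) y h) \<le> M * dist x y"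
    and hess_log_p_lipschitz: "\<exists>M. \<forall>z\<in>space \<nu>. \<forall>x\<in>C. \<forall>y\<in>C.
      onorm (\<lambda>h. hessian (\<lambda>u. ln (p z u)) x h - hessian (\<lambda>u. ln (p z u)) y h) \<le> M * dist x y"
    and objective_twice_differentiable: "twice_differentiable_on (objective \<nu> p Ft) U"
    and objective_hessian_continuous: "\<And>h. continuous_on U (\<lambda>x. hessian (objective \<nu> p Ft) x h)"
    and gradient_unbiased: "\<And>x. x \<in> C \<Longrightarrow>
      (LINT z|sample_law \<nu> p x. gradient (\<lambda>y. Ft y z) x) = gradient (objective \<nu> p Ft) x"

section \<open>The algorithm SFW++\<close>

text \<open>Conditionally on the history \<open>H\<close>, the draws \<open>Y 0, \<dots>, Y (n - 1)\<close> are independent and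
  each has law \<open>\<kappa> \<omega>\<close>.\<close>

definition conditionally_iid ::
    "'w measure \<Rightarrow> 'w measure \<Rightarrow> nat \<Rightarrow> 's measure \<Rightarrow> ('w \<Rightarrow> 's measure) \<Rightarrow> (nat \<Rightarrow> 'w \<Rightarrow> 's) \<Rightarrow> bool"
  where
  "conditionally_iid P H n S \<kappa> Y \<longleftrightarrow>
     (\<forall>j<n. Y j \<in> measurable P S) \<and>
     (\<forall>E\<in>sets H. \<forall>A. (\<forall>j<n. A j \<in> sets S) \<longrightarrow>
        emeasure P {\<omega>\<in>E. \<forall>j<n. Y j \<omega> \<in> A j} =
        (\<integral>\<^sup>+\<omega>\<in>E. (\<Prod>j<n. emeasure (\<kappa> \<omega>) (A j)) \<partial>P))"

text \<open>Pairs \<open>(a, z(a))\<close> live on \<open>[0,1] \<times> \<Z>\<close>; \<open>path_law \<nu> p x y\<close> is the law with \<open>a\<close> uniform and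
  \<open>z(a) \<sim> p(\<cdot>; a x + (1 - a) y)\<close>.\<close>

definition path_space :: "'z measure \<Rightarrow> (real \<times> 'z) measure" where
  "path_space \<nu> = restrict_space lborel {0..1} \<Otimes>\<^sub>M \<nu>"

definition path_law ::
    "'z measure \<Rightarrow> ('z \<Rightarrow> 'a::euclidean_space \<Rightarrow> real) \<Rightarrow> 'a \<Rightarrow> 'a \<Rightarrow> (real \<times> 'z) measure" where
  "path_law \<nu> p x y =
     density (path_space \<nu>) (\<lambda>(a, z). ennreal (p z (a *\<^sub>R x + (1 - a) *\<^sub>R y)))"

text \<open>Stochastic Hessian, applied to a direction \<open>h\<close>: with \<open>s = \<nabla> log p(z;x)\<close> and
  \<open>g = \<nabla>F~(x;z)\<close> it is
  \<open>F~ s s\<^sup>T + g s\<^sup>T + s g\<^sup>T + \<nabla>\<^sup>2F~ + F~ \<nabla>\<^sup>2 log p\<close>, the integrand obtained by differentiating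
  \<open>\<integral> F~(x;z) p(z;x) dz\<close> twice under the integral sign.\<close>

definition stochastic_hessian ::
    "('z \<Rightarrow> 'a::euclidean_space \<Rightarrow> real) \<Rightarrow> ('a \<Rightarrow> 'z \<Rightarrow> real) \<Rightarrow> 'a \<Rightarrow> 'z \<Rightarrow> 'a \<Rightarrow> 'a" where
  "stochastic_hessian p Ft x z h =
     (let s = gradient (\<lambda>y. ln (p z y)) x; g = gradient (\<lambda>y. Ft y z) x in
        (Ft x z * (s \<bullet> h)) *\<^sub>R s + (s \<bullet> h) *\<^sub>R g + (g \<bullet> h) *\<^sub>R s
        + hessian (\<lambda>y. Ft y z) x h + Ft x z *\<^sub>R hessian (\<lambda>y. ln (p z y)) x h)"

definition refresh :: "nat \<Rightarrow> bool" where
  "refresh t \<longleftrightarrow> t = 0 \<or> (\<exists>k. t = 2 ^ k)"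

text \<open>A run on the probability space \<open>P\<close>: \<open>H t\<close> is the history before the draws of iteration
  \<open>t\<close>, \<open>m0 t\<close> and \<open>mh t\<close> are the minibatch sizes, \<open>Z0 t j\<close> and \<open>(A t j, Zh t j)\<close> the samples,
  \<open>x\<close> the iterates, \<open>g\<close> the gradient estimates, \<open>v\<close> the vertices returned by linear maximization.
  Ties in the linear maximization may be broken arbitrarily, as long as \<open>v t\<close> is determined by
  the history after iteration \<open>t\<close>.\<close>

locale sfwpp_run = prob_space P + filtration "space P" H
  for P :: "'w measure" and H :: "nat \<Rightarrow> 'w measure" +
  fixes C :: "'a::euclidean_space set"
    and \<nu> :: "'z measure"
    and p :: "'z \<Rightarrow> 'a \<Rightarrow> real"
    and Ft :: "'a \<Rightarrow> 'z \<Rightarrow> real"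
    and x0 :: 'a
    and m0 mh :: "nat \<Rightarrow> nat"
    and Z0 :: "nat \<Rightarrow> nat \<Rightarrow> 'w \<Rightarrow> 'z"
    and A :: "nat \<Rightarrow> nat \<Rightarrow> 'w \<Rightarrow> real"
    and Zh :: "nat \<Rightarrow> nat \<Rightarrow> 'w \<Rightarrow> 'z"
    and x g v :: "nat \<Rightarrow> 'w \<Rightarrow> 'a"
  assumes history_sub: "\<And>t. sets (H t) \<subseteq> sets P"
    and x_adapted: "\<And>t. x t \<in> borel_measurable (H t)"
    and g_adapted: "\<And>t. g t \<in> borel_measurable (H (Suc t))"
    and v_adapted: "\<And>t. v t \<in> borel_measurable (H (Suc t))"
    and refresh_adapted: "\<And>t j. refresh t \<Longrightarrow> j < m0 t \<Longrightarrow> Z0 t j \<in> measurable (H (Suc t)) \<nu>"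
    and refresh_draws: "\<And>t. refresh t \<Longrightarrow>
      conditionally_iid P (H t) (m0 t) \<nu> (\<lambda>\<omega>. sample_law \<nu> p (x t \<omega>)) (Z0 t)"
    and refresh_gradient: "\<And>t \<omega>. refresh t \<Longrightarrow> \<omega> \<in> space P \<Longrightarrow>
      g t \<omega> = (1 / real (m0 t)) *\<^sub>R (\<Sum>j<m0 t. gradient (\<lambda>y. Ft y (Z0 t j \<omega>)) (x t \<omega>))"
    and path_adapted: "\<And>t j. \<not> refresh t \<Longrightarrow> j < mh t \<Longrightarrow>
      (\<lambda>\<omega>. (A t j \<omega>, Zh t j \<omega>)) \<in> measurable (H (Suc t)) (path_space \<nu>)"
    and path_draws: "\<And>t. \<not> refresh t \<Longrightarrow>
      conditionally_iid P (H t) (mh t) (path_space \<nu>)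
        (\<lambda>\<omega>. path_law \<nu> p (x t \<omega>) (x (t - 1) \<omega>)) (\<lambda>j \<omega>. (A t j \<omega>, Zh t j \<omega>))"
    and path_gradient: "\<And>t \<omega>. \<not> refresh t \<Longrightarrow> \<omega> \<in> space P \<Longrightarrow>
      g t \<omega> = g (t - 1) \<omega> + (1 / real (mh t)) *\<^sub>R
        (\<Sum>j<mh t. stochastic_hessian p Ft
          (A t j \<omega> *\<^sub>R x t \<omega> + (1 - A t j \<omega>) *\<^sub>R x (t - 1) \<omega>) (Zh t j \<omega>) (x t \<omega> - x (t - 1) \<omega>))"
    and linear_maximization: "\<And>t \<omega>. \<omega> \<in> space P \<Longrightarrow>
      v t \<omega> \<in> C \<and> (\<forall>u\<in>C. u \<bullet> g t \<omega> \<le> v t \<omega> \<bullet> g t \<omega>)"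
    and init: "\<And>\<omega>. \<omega> \<in> space P \<Longrightarrow> x 0 \<omega> = x0"
    and update: "\<And>t \<omega>. \<omega> \<in> space P \<Longrightarrow>
      x (Suc t) \<omega> = x t \<omega> + (2 / (real t + 2)) *\<^sub>R (v t \<omega> - x t \<omega>)"

end

theory Submission
  imports Defs
begin

text \<open>Unbiasedness and the bound on \<open>\<nabla>F~\<close> make \<open>F\<close> \<open>GF\<close>-Lipschitz on \<open>C\<close>, so
  \<open>\<Delta> = F(x*) - F(x0) \<le> G D\<close>. The path batches cost \<open>O(t\<^sup>2)\<close>. The refresh batches form a
  geometric sum, of order \<open>G\<^sup>2 t\<^sup>2 / (Lbar\<^sup>2 D\<^sup>2) + K\<close>, where the second term comes from rounding
  and is at most \<open>t\<close>. Now substitute \<open>t\<^sup>2 = O(Lbar\<^sup>2 D\<^sup>4 + \<Delta>\<^sup>2) / \<epsilon>\<^sup>2\<close>: in the refresh cost the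
  \<open>\<Delta>\<^sup>2\<close> gives the third term of the claim, and in the path cost it is absorbed into
  \<open>G\<^sup>2 D\<^sup>2 / \<epsilon>\<^sup>2\<close>.\<close>

context stochastic_problem
begin

text \<open>A probability space is nonempty, so the gradient bound has at least one instance, and a
  norm is nonnegative.\<close>

lemma GF_nonneg: "GF \<ge> 0"
proof -
  obtain x where x: "x \<in> C"
    using domain(1) by blast
  then have "x \<in> U"
    using domain(6) by blast
  then have "space (sample_law \<nu> p x) \<noteq> {}"
    by (intro prob_space.not_empty density_prob)
  then obtain z where "z \<in> space \<nu>"
    by (auto simp: sample_law_def)
  from grad_Ft_bound[OF x this] show ?thesis
    using norm_ge_zero order_trans by blast
qed

lemma norm_gradient_objective_le:
  assumes "x \<in> C"
  shows "norm (gradient (objective \<nu> p Ft) x) \<le> GF"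
proof -
  interpret M: prob_space "sample_law \<nu> p x"
    using assms domain(6) by (intro density_prob) blast
  let ?f = "\<lambda>z. gradient (\<lambda>y. Ft y z) x"
  have "norm (LINT z|sample_law \<nu> p x. ?f z) \<le> GF"
  proof (cases "integrable (sample_law \<nu> p x) ?f")
    case True
    have "norm (LINT z|sample_law \<nu> p x. ?f z) \<le> (LINT z|sample_law \<nu> p x. norm (?f z))"
      by simp
    also have "\<dots> \<le> (LINT z|sample_law \<nu> p x. GF)"
    proof (intro integral_mono integrable_norm True M.integrable_const)
      fix z assume "z \<in> space (sample_law \<nu> p x)"
      then show "norm (?f z) \<le> GF"
        by (intro grad_Ft_bound assms) (simp add: sample_law_def)
    qed
    also have "\<dots> = GF"
      by (simp add: M.prob_space)
    finally show ?thesis .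
  \<comment> \<open>Without integrability the Bochner integral takes its default value 0, and the
    claim reduces to \<open>GF \<ge> 0\<close>.\<close>
  qed (simp add: not_integrable_integral_eq GF_nonneg)
  then show ?thesis
    using gradient_unbiased[OF assms] by simp
qed

text \<open>Mean value inequality on the convex set \<open>C\<close>. The derivative is taken within
  \<open>C\<close>, where the gradient bound is available.\<close>

lemma objective_lipschitz:
  assumes "x \<in> C" "y \<in> C"
  shows "\<bar>objective \<nu> p Ft x - objective \<nu> p Ft y\<bar> \<le> GF * norm (x - y)"
proof -
  let ?F = "objective \<nu> p Ft"
  have "(?F has_derivative (\<lambda>h. h \<bullet> gradient ?F u)) (at u within C)" if "u \<in> C" for u
    using that domain(6) objective_twice_differentiable differentiable_imp_GDERIV[of ?F u]
    unfolding twice_differentiable_on_def gderiv_def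
    by (blast intro: has_derivative_at_withinI)
  moreover have "onorm (\<lambda>h. h \<bullet> gradient ?F u) \<le> GF" if "u \<in> C" for u
  proof (rule onorm_le)
    fix h
    have "norm (h \<bullet> gradient ?F u) \<le> norm h * norm (gradient ?F u)"
      by (simp add: Cauchy_Schwarz_ineq2)
    also have "\<dots> \<le> GF * norm h"
      using norm_gradient_objective_le[OF that] by (metis mult.commute mult_right_mono norm_ge_zero)
    finally show "norm (h \<bullet> gradient ?F u) \<le> GF * norm h" .
  qed
  ultimately have "norm (?F x - ?F y) \<le> GF * norm (x - y)"
    using assms by (intro differentiable_bound[OF domain(2)])
  then show ?thesis
    by simp
qed

lemma objective_gap_le_diameter:
  assumes "x \<in> C" "y \<in> C"
  shows "\<bar>objective \<nu> p Ft x - objective \<nu> p Ft y\<bar> \<le> GF * diameter C"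
proof -
  have "norm (x - y) \<le> diameter C"
    using diameter_bounded_bound[OF compact_imp_bounded[OF domain(3)] assms]
    by (simp add: dist_norm)
  then show ?thesis
    using objective_lipschitz[OF assms] GF_nonneg by (meson mult_left_mono order_trans)
qed

end

lemma sum_path_batches_le:
  fixes t :: nat
  assumes "t \<ge> 1"
  shows "real (\<Sum>i=0..t. 16 * (i + 2)) \<le> 80 * (real t)\<^sup>2"
proof -
  have "(\<Sum>i=0..t. 16 * (i + 2)) = 8 * (t + 1) * (t + 4)"
    by (induction t) (auto simp: algebra_simps)
  then have "real (\<Sum>i=0..t. 16 * (i + 2)) = 8 * (real t + 1) * (real t + 4)"
    by (simp only:) simp
  also have "\<dots> \<le> 8 * (2 * real t) * (5 * real t)"
    using assms by (intro mult_mono) auto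
  finally show ?thesis
    by (simp add: power2_eq_square)
qed

text \<open>Here \<open>b\<close> stands for \<open>G\<^sup>2 / (Lbar\<^sup>2 * D\<^sup>2)\<close>.
  Each ceiling costs at most 1, and the \<open>K + 1\<close> of them together at most
  \<open>2 ^ K\<close>.\<close>

lemma sum_refresh_batches_le:
  fixes b :: real
  assumes "b \<ge> 0"
  shows "real (\<Sum>k=0..K. nat \<lceil>b * (real (2 ^ k) + 1)\<^sup>2\<rceil>) \<le> 16 / 3 * b * (2 ^ K)\<^sup>2 + 2 ^ K"
proof -
  have batch: "real (nat \<lceil>b * (real (2 ^ k) + 1)\<^sup>2\<rceil>) \<le> 4 * b * 4 ^ k + 1" for k :: nat
  proof -
    \<comment> \<open>Since \<open>2 ^ k \<ge> 1\<close>, the added 1 at most doubles the base,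
      leaving a geometric sequence of ratio 4.\<close>
    have "(real (2 ^ k) + 1)\<^sup>2 \<le> (2 * 2 ^ k)\<^sup>2"
      by (intro power_mono) auto
    also have "\<dots> = (4::real) * 4 ^ k"
      by (simp add: power2_eq_square flip: power_mult_distrib)
    finally have "b * (real (2 ^ k) + 1)\<^sup>2 \<le> 4 * b * 4 ^ k"
      using mult_left_mono[OF _ assms] by fastforce
    moreover have "b * (real (2 ^ k) + 1)\<^sup>2 \<ge> 0"
      using assms by simp
    ultimately show ?thesis
      by linarith
  qed
  have "(\<Sum>k=0..K. 4 ^ k) = (4 * 4 ^ K - 1) / (3::real)"
    by (induction K) (auto simp: field_simps)
  then have geometric: "(\<Sum>k=0..K. 4 ^ k) \<le> 4 / 3 * (4::real) ^ K"
    by simp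
  have "real (\<Sum>k=0..K. nat \<lceil>b * (real (2 ^ k) + 1)\<^sup>2\<rceil>) \<le> (\<Sum>k=0..K. 4 * b * 4 ^ k + 1)"
    unfolding of_nat_sum by (intro sum_mono batch)
  also have "\<dots> = 4 * b * (\<Sum>k=0..K. 4 ^ k) + real (Suc K)"
    by (simp add: sum.distrib sum_distrib_left)
  also have "\<dots> \<le> 4 * b * (4 / 3 * 4 ^ K) + 2 ^ K"
  proof (intro add_mono mult_left_mono geometric)
    have "Suc K \<le> 2 ^ K"
      by (rule Suc_leI[OF less_exp])
    then show "real (Suc K) \<le> 2 ^ K"
      by (metis of_nat_le_iff of_nat_numeral of_nat_power)
  qed (use assms in auto)
  also have "(4::real) ^ K = (2 ^ K)\<^sup>2"
    by (simp add: power2_eq_square flip: power_mult_distrib)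
  finally show ?thesis
    by simp
qed

text \<open>The purely numerical part: \<open>L\<close> plays the role of \<open>Lbar\<close>, and
  \<Delta> that of the optimality gap at \<open>x0\<close>.\<close>

lemma complexity_bound:
  fixes \<Delta> D G L \<epsilon> :: real and t :: nat
  assumes pos: "L > 0" "D > 0" "\<epsilon> > 0"
    and \<Delta>: "0 \<le> \<Delta>" "\<Delta> \<le> G * D"
    and t: "real t = (28 * L * D\<^sup>2 + \<Delta>) / \<epsilon>" "t = 2 ^ K"
  shows "real (\<Sum>i=0..t. 16 * (i + 2))
      + real (\<Sum>k=0..K. nat \<lceil>G\<^sup>2 * (real (2 ^ k) + 1)\<^sup>2 / (L\<^sup>2 * D\<^sup>2)\<rceil>)
    \<le> 10 ^ 6 * (L\<^sup>2 * D ^ 4 / \<epsilon>\<^sup>2 + G\<^sup>2 * D\<^sup>2 / \<epsilon>\<^sup>2 + G\<^sup>2 * \<Delta>\<^sup>2 / (L\<^sup>2 * D\<^sup>2 * \<epsilon>\<^sup>2))"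
proof -
  define b where "b = G\<^sup>2 / (L\<^sup>2 * D\<^sup>2)"
  define X where "X = L\<^sup>2 * D ^ 4 / \<epsilon>\<^sup>2"
  define Y where "Y = G\<^sup>2 * D\<^sup>2 / \<epsilon>\<^sup>2"
  define Z where "Z = G\<^sup>2 * \<Delta>\<^sup>2 / (L\<^sup>2 * D\<^sup>2 * \<epsilon>\<^sup>2)"
  have nonneg: "b \<ge> 0" "X \<ge> 0" "Y \<ge> 0" "Z \<ge> 0"
    by (simp_all add: b_def X_def Y_def Z_def)
  have t1: "t \<ge> 1"
    using t(2) by simp
  \<comment> \<open>The cross term is removed by expanding the square of the difference; below,
    \<open>1568 = 2 * 28\<^sup>2\<close>.\<close>
  have "(28 * L * D\<^sup>2 + \<Delta>)\<^sup>2 \<le> 2 * (28 * L * D\<^sup>2)\<^sup>2 + 2 * \<Delta>\<^sup>2"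
    using zero_le_power2[of "28 * L * D\<^sup>2 - \<Delta>"] unfolding power2_sum power2_diff by linarith
  then have "(real t)\<^sup>2 \<le> (2 * (28 * L * D\<^sup>2)\<^sup>2 + 2 * \<Delta>\<^sup>2) / \<epsilon>\<^sup>2"
    unfolding t(1) power_divide by (rule divide_right_mono) simp
  also have "\<dots> = 1568 * X + 2 * (\<Delta>\<^sup>2 / \<epsilon>\<^sup>2)"
    by (simp add: X_def power_mult_distrib add_divide_distrib)
  finally have t_sq: "(real t)\<^sup>2 \<le> 1568 * X + 2 * (\<Delta>\<^sup>2 / \<epsilon>\<^sup>2)" .
  have "\<Delta>\<^sup>2 \<le> (G * D)\<^sup>2"
    using \<Delta> by (intro power_mono)
  then have "\<Delta>\<^sup>2 / \<epsilon>\<^sup>2 \<le> Y"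
    unfolding Y_def power_mult_distrib by (rule divide_right_mono) simp
  with t_sq have path: "(real t)\<^sup>2 \<le> 1568 * X + 2 * Y"
    by linarith
  \<comment> \<open>This starts from \<open>t_sq\<close> rather than \<open>path\<close>, because
    \<open>b * X = Y\<close> and \<open>b * (\<Delta>\<^sup>2 / \<epsilon>\<^sup>2) = Z\<close> hold
    exactly.\<close>
  have "b * (real t)\<^sup>2 \<le> b * (1568 * X + 2 * (\<Delta>\<^sup>2 / \<epsilon>\<^sup>2))"
    by (rule mult_left_mono[OF t_sq nonneg(1)])
  also have "\<dots> = 1568 * Y + 2 * Z"
    using pos by (simp add: b_def X_def Y_def Z_def field_simps power2_eq_square power4_eq_xxxx)
  finally have refresh: "b * (real t)\<^sup>2 \<le> 1568 * Y + 2 * Z" .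
  have refresh_sum: "real (\<Sum>k=0..K. nat \<lceil>G\<^sup>2 * (real (2 ^ k) + 1)\<^sup>2 / (L\<^sup>2 * D\<^sup>2)\<rceil>)
      \<le> 16 / 3 * (b * (real t)\<^sup>2) + real t"
    using sum_refresh_batches_le[OF nonneg(1), of K] by (simp add: b_def t(2))
  have t_le: "real t \<le> (real t)\<^sup>2"
    using t1 by (simp add: power2_eq_square)
  have "real (\<Sum>i=0..t. 16 * (i + 2))
      + real (\<Sum>k=0..K. nat \<lceil>G\<^sup>2 * (real (2 ^ k) + 1)\<^sup>2 / (L\<^sup>2 * D\<^sup>2)\<rceil>)
    \<le> 80 * (real t)\<^sup>2 + (16 / 3 * (b * (real t)\<^sup>2) + real t)"
    by (intro add_mono sum_path_batches_le t1 refresh_sum)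
  \<comment> \<open>The rounding term \<open>t\<close> is at most \<open>t\<^sup>2\<close>, which
    turns 80 into 81.\<close>
  also have "\<dots> \<le> 81 * (1568 * X + 2 * Y) + 16 / 3 * (1568 * Y + 2 * Z)"
  proof -
    have "80 * u + (16 / 3 * w + v) \<le> 81 * a + 16 / 3 * c"
      if "u \<le> a" "w \<le> c" "v \<le> u" for a c u v w :: real
      using that by linarith
    then show ?thesis
      using path refresh t_le by blast
  qed
  \<comment> \<open>The largest coefficient is that of \<open>X\<close>, namely
    \<open>81 * 1568 = 127008\<close>.\<close>
  also have "\<dots> \<le> 10 ^ 6 * (X + Y + Z)"
    using nonneg by simp
  finally show ?thesis
    unfolding X_def Y_def Z_def .
qed

(* The implied constant is chosen before all problem data. HOL cannot quantify over types, so the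
   numeric cap on c is what makes it independent also of the type variables, i.e. of the
   dimension d = DIM('a), of the sample space and of the probability space. The real-valued
   batch size is rounded up to the number of samples drawn. *)
theorem corollary3p8:
  shows "\<exists>c::real. 0 < c \<and> c \<le> 10 ^ 6 \<and>
    (\<forall>(C :: 'a::euclidean_space set) U (\<nu> :: 'z measure) p Ft B GF Gp LF Lp
       D G L Lbar xs x0 \<epsilon> (t::nat) (K::nat)
       (P :: 'w measure) H m0 mh Z0 A Zh x g v.
       stochastic_problem C U \<nu> p Ft B GF Gp LF Lp
       \<longrightarrow> D = diameter C
       \<longrightarrow> G = max GF Gp
       \<longrightarrow> L = max LF Lp
       \<longrightarrow> Lbar > 0
       \<longrightarrow> Lbar\<^sup>2 = 4 * B\<^sup>2 * G ^ 4 + 16 * G ^ 4 + 4 * L\<^sup>2 + 4 * B\<^sup>2 * L\<^sup>2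
       \<longrightarrow> concave_on C (objective \<nu> p Ft)
       \<longrightarrow> xs \<in> C \<and> (\<forall>y\<in>C. objective \<nu> p Ft y \<le> objective \<nu> p Ft xs)
       \<longrightarrow> x0 \<in> C
       \<longrightarrow> (\<forall>i. mh i = 16 * (i + 2))
       \<longrightarrow> (\<forall>i. m0 i = nat \<lceil>G\<^sup>2 * (real i + 1)\<^sup>2 / (Lbar\<^sup>2 * D\<^sup>2)\<rceil>)
       \<longrightarrow> sfwpp_run P H C \<nu> p Ft x0 m0 mh Z0 A Zh x g v
       \<longrightarrow> \<epsilon> > 0
       \<longrightarrow> real t = (28 * Lbar * D\<^sup>2 + (objective \<nu> p Ft xs - objective \<nu> p Ft x0)) / \<epsilon>
       \<longrightarrow> t = 2 ^ K
       \<longrightarrow> real (\<Sum>i=0..t. mh i) + real (\<Sum>k=0..K. m0 (2 ^ k))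
           \<le> c * (Lbar\<^sup>2 * D ^ 4 / \<epsilon>\<^sup>2 + G\<^sup>2 * D\<^sup>2 / \<epsilon>\<^sup>2
                  + G\<^sup>2 * (objective \<nu> p Ft xs - objective \<nu> p Ft x0)\<^sup>2 / (Lbar\<^sup>2 * D\<^sup>2 * \<epsilon>\<^sup>2)))"
proof (intro exI[of _ "10 ^ 6"] conjI allI impI, goal_cases)
  case (3 C U \<nu> p Ft B GF Gp LF Lp D G L Lbar xs x0 \<epsilon> t K P H m0 mh)
  interpret stochastic_problem C U \<nu> p Ft B GF Gp LF Lp
    by (fact 3(1))
  let ?\<Delta> = "objective \<nu> p Ft xs - objective \<nu> p Ft x0"
  have D: "D > 0"
    using 3 domain(4) by simp
  \<comment> \<open>The Lipschitz constant is \<open>GF\<close>; the passage to \<open>G\<close>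
    uses \<open>G = max GF Gp\<close>.\<close>
  have "?\<Delta> \<le> GF * D"
    using 3 objective_gap_le_diameter[of xs x0] by simp
  also have "\<dots> \<le> G * D"
    using 3 D by (intro mult_right_mono) auto
  finally have "?\<Delta> \<le> G * D" .
  moreover have "0 \<le> ?\<Delta>"
    using 3 by simp
  moreover have batches: "mh = (\<lambda>i. 16 * (i + 2))"
    "m0 = (\<lambda>i. nat \<lceil>G\<^sup>2 * (real i + 1)\<^sup>2 / (Lbar\<^sup>2 * D\<^sup>2)\<rceil>)"
    using 3(10,11) by auto
  ultimately show ?case
    unfolding batches using 3 D by (intro complexity_bound) simp_all
qed simp_all

end
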